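(* Let $m$ be a positive integer and let $\{T(t)\}_{t\ge 0}$ be a $C_0$-semigroup on a complex Hilbert space $H$. Then the following properties are equivalent: (i) $T(t)$ is an $m$-isometry for every $t\ge 0$. (ii) There exists $t_1>0$ such that $T(t)$ is an $m$-isometry for every $t\in[0,t_1]$. (iii) There exist $0<t_1<t_2$ such that $T(t)$ is an $m$-isometry for every $t\in[t_1,t_2]$.
   Context: A $C_0$-semigroup on $H$ is a family $\{T(t)\}_{t\ge0}$ of bounded linear operators on $H$ with $T(0)=I$, $T(s+t)=T(t)T(s)$ for all $s,t\ge 0$, and $\lim_{t\to0^+}T(t)x=x$ for every $x\in H$. A bounded operator $T$ on $H$ is an $m$-isometry if $\sum_{k=0}^m\binom{m}{k}(-1)^{m-k}\|T^kx\|^2=0$ for all $x\in H$. *)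

theory Defs
  imports "HOL-Analysis.Analysis"
begin

text \<open>The real scalar multiplication of the type is the restriction of the complex one, so that
  the library's real normed spaces provide norm, topology and completeness.\<close>

class complex_vector = real_vector +
  fixes scaleC :: "complex \<Rightarrow> 'a \<Rightarrow> 'a" (infixr "*\<^sub>C" 75)
  assumes scaleC_add_right: "c *\<^sub>C (x + y) = c *\<^sub>C x + c *\<^sub>C y"
    and scaleC_add_left: "(c + d) *\<^sub>C x = c *\<^sub>C x + d *\<^sub>C x"
    and scaleC_scaleC: "c *\<^sub>C d *\<^sub>C x = (c * d) *\<^sub>C x"
    and scaleC_one: "1 *\<^sub>C x = x"
    and scaleR_scaleC: "r *\<^sub>R x = complex_of_real r *\<^sub>C x"

text \<open>The inner product is linear in the first argument. The norm axioms inherited from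
  \<^class>\<open>real_normed_vector\<close> follow from the axioms below and impose no extra
  condition.\<close>

class complex_inner = complex_vector + real_normed_vector +
  fixes cinner :: "'a \<Rightarrow> 'a \<Rightarrow> complex"
  assumes cinner_commute: "cinner x y = cnj (cinner y x)"
    and cinner_add_left: "cinner (x + y) z = cinner x z + cinner y z"
    and cinner_scaleC_left: "cinner (c *\<^sub>C x) y = c * cinner x y"
    and cinner_ge_zero: "0 \<le> Re (cinner x x)"
    and cinner_eq_zero_iff: "cinner x x = 0 \<longleftrightarrow> x = 0"
    and norm_eq_sqrt_cinner: "norm x = sqrt (Re (cinner x x))"

class complex_hilbert_space = complex_inner + complete_space

subclass (in complex_hilbert_space) banach ..

instantiation complex :: complex_hilbert_space
begin

definition scaleC_complex :: "complex \<Rightarrow> complex \<Rightarrow> complex"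
  where "scaleC_complex c x = c * x"

definition cinner_complex :: "complex \<Rightarrow> complex \<Rightarrow> complex"
  where "cinner_complex x y = x * cnj y"

instance
  by standard
    (auto simp: scaleC_complex_def cinner_complex_def algebra_simps scaleR_conv_of_real
      cmod_def power2_eq_square)

end

definition bounded_clinear :: "('a::complex_inner \<Rightarrow> 'b::complex_inner) \<Rightarrow> bool"
  where "bounded_clinear A \<longleftrightarrow> bounded_linear A \<and> (\<forall>c x. A (c *\<^sub>C x) = c *\<^sub>C A x)"

text \<open>Only the values at nonnegative times are constrained.\<close>

definition C0_semigroup :: "(real \<Rightarrow> 'a::complex_hilbert_space \<Rightarrow> 'a) \<Rightarrow> bool"
  where "C0_semigroup T \<longleftrightarrow>
    (\<forall>t\<ge>0. bounded_clinear (T t)) \<and>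
    T 0 = id \<and>
    (\<forall>s\<ge>0. \<forall>t\<ge>0. T (s + t) = T t \<circ> T s) \<and>
    (\<forall>x. ((\<lambda>t. T t x) \<longlongrightarrow> x) (at_right 0))"

definition m_isometry :: "nat \<Rightarrow> ('a::complex_hilbert_space \<Rightarrow> 'a) \<Rightarrow> bool"
  where "m_isometry m A \<longleftrightarrow> bounded_clinear A \<and>
    (\<forall>x. (\<Sum>k=0..m. real (m choose k) * (-1) ^ (m - k) * (norm ((A ^^ k) x))\<^sup>2) = 0)"

end

theory Submission
  imports Defs "HOL-Computational_Algebra.Polynomial"
begin

text \<open>Fix \<open>x\<close> and let \<open>E\<close> be the shift on sequences. For \<open>g k = \<parallel>A\<^sup>k x\<parallel>\<^sup>2\<close>, the
  operator \<open>A\<^sup>n\<close> is an \<open>m\<close>-isometry iff \<open>(E\<^sup>n - 1)\<^sup>m\<close> annihilates all these \<open>g\<close>. The annihilator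
  of a sequence is an ideal of \<open>\<real>[E]\<close>. Since \<open>E - 1\<close> divides \<open>E\<^sup>n - 1\<close>, powers of \<open>m\<close>-isometries
  are \<open>m\<close>-isometries. Since \<open>(E - 1)\<^sup>m\<close> generates the ideal of \<open>(E\<^sup>n - 1)\<^sup>m\<close> and
  \<open>(E\<^sup>n\<^sup>+\<^sup>1 - 1)\<^sup>m\<close>, conversely \<open>A\<close> is an \<open>m\<close>-isometry if \<open>A\<^sup>n\<close> and \<open>A\<^sup>n\<^sup>+\<^sup>1\<close> are. If \<open>h > 0\<close> is small,
  two consecutive multiples of \<open>h\<close> lie in \<open>[t\<^sub>1, t\<^sub>2]\<close>, so \<open>T(h)\<close> is an \<open>m\<close>-isometry, and hence so
  is \<open>T(t) = T(t/N)\<^sup>N\<close> for all \<open>t\<close>.\<close>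

section \<open>Polynomials in the shift acting on sequences\<close>

definition shift_act :: "'a::comm_ring_1 poly \<Rightarrow> (nat \<Rightarrow> 'a) \<Rightarrow> nat \<Rightarrow> 'a"
  where "shift_act p g s = (\<Sum>i\<le>degree p. coeff p i * g (s + i))"

text \<open>Coefficients beyond the degree vanish, so polynomials of different degrees can share one
  summation range.\<close>

lemma shift_act_altdef:
  assumes "degree p \<le> N"
  shows "shift_act p g s = (\<Sum>i\<le>N. coeff p i * g (s + i))"
  unfolding shift_act_def
proof (rule sum.mono_neutral_left)
  show "\<forall>i\<in>{..N} - {..degree p}. coeff p i * g (s + i) = 0"
    by (simp add: coeff_eq_0 not_le)
qed (use assms in auto)

lemma shift_act_0 [simp]: "shift_act 0 g s = 0"
  by (simp add: shift_act_def)

lemma shift_act_add: "shift_act (p + q) g s = shift_act p g s + shift_act q g s"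
proof -
  let ?N = "max (degree p) (degree q)"
  have "degree (p + q) \<le> ?N" by (rule degree_add_le) auto
  then show ?thesis
    by (simp add: shift_act_altdef[where N = ?N] ring_distribs sum.distrib)
qed

lemma shift_act_sum: "shift_act (\<Sum>k\<in>K. p k) g s = (\<Sum>k\<in>K. shift_act (p k) g s)"
  by (induction K rule: infinite_finite_induct) (simp_all add: shift_act_add)

lemma shift_act_smult: "shift_act (smult c p) g s = c * shift_act p g s"
proof -
  have "shift_act (smult c p) g s = (\<Sum>i\<le>degree p. coeff (smult c p) i * g (s + i))"
    by (rule shift_act_altdef) (rule degree_smult_le)
  then show ?thesis by (simp add: shift_act_def sum_distrib_left mult.assoc)
qed

lemma shift_act_pCons_0: "shift_act (pCons 0 p) g s = shift_act p g (Suc s)"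
proof -
  have "shift_act (pCons 0 p) g s = (\<Sum>i\<le>Suc (degree p). coeff (pCons 0 p) i * g (s + i))"
    by (rule shift_act_altdef) (rule degree_pCons_le)
  also have "\<dots> = shift_act p g (Suc s)"
    by (simp add: sum.atMost_Suc_shift shift_act_def del: sum.atMost_Suc)
  finally show ?thesis .
qed

lemma shift_act_monom: "shift_act (monom c k) g s = c * g (s + k)"
proof (induction k arbitrary: s)
  case 0
  then show ?case by (simp add: monom_0 shift_act_def)
next
  case (Suc k)
  then show ?case by (simp add: monom_Suc shift_act_pCons_0)
qed

text \<open>This is the ideal property of the annihilator. Multiplying by the variable moves the
  starting point, so annihilation is assumed at every \<open>s\<close>.\<close>

lemma shift_act_mult_eq_0:
  assumes "\<And>s. shift_act p g s = 0"
  shows "shift_act (q * p) g s = 0"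
proof (induction q arbitrary: s)
  case 0
  then show ?case by simp
next
  case (pCons a q)
  then show ?case
    by (simp add: shift_act_add shift_act_smult shift_act_pCons_0 assms)
qed

lemma shift_act_dvd:
  assumes "\<And>s. shift_act p g s = 0" and "p dvd q"
  shows "shift_act q g s = 0"
  using assms shift_act_mult_eq_0 by (metis dvdE mult.commute)

lemma shift_act_difference_power:
  "shift_act ((monom 1 n - 1) ^ m) g s =
    (\<Sum>k=0..m. of_nat (m choose k) * (-1) ^ (m - k) * g (s + k * n))"
proof -
  \<comment> \<open>With -1 written as a monomial, every term of the binomial expansion is a
    monomial.\<close>
  have "(- 1 :: 'a poly) = monom (-1) 0"
    by (simp add: minus_monom[symmetric] del: minus_monom)
  then have "(monom 1 n - 1 :: 'a poly) ^ m = (monom 1 n + monom (-1) 0) ^ m"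
    by (simp only: diff_conv_add_uminus)
  also have "\<dots> = (\<Sum>k\<le>m. of_nat (m choose k) * monom 1 n ^ k * monom (-1) 0 ^ (m - k))"
    by (rule binomial_ring)
  also have "\<dots> = (\<Sum>k\<le>m. monom (of_nat (m choose k) * (-1) ^ (m - k)) (k * n))"
    by (intro sum.cong refl)
      (simp add: monom_power mult_monom of_nat_poly flip: monom_0, simp add: mult.commute)
  finally show ?thesis
    by (simp add: shift_act_sum shift_act_monom atLeast0AtMost)
qed

section \<open>Divisibility and Bezout identities\<close>

lemma monom_minus_1_dvd: "(monom 1 1 - 1 :: 'a::comm_ring_1 poly) dvd monom 1 n - 1"
proof -
  have "(monom 1 n :: 'a poly) = monom 1 1 ^ n" by (simp add: monom_power)
  then show ?thesis
    by (simp only: power_diff_1_eq dvd_triv_left)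
qed

text \<open>Here \<open>b * y\<close> equals \<open>1 - a * x\<close>, which divides
  \<open>1 - (a * x) ^ m\<close>.\<close>

lemma bezout_power_left:
  fixes x y :: "'a::comm_ring_1"
  assumes "a * x + b * y = 1"
  obtains c d where "c * x ^ m + d * y = 1"
proof -
  have "b * y = 1 - a * x" using assms by (simp add: algebra_simps)
  then have "b * y dvd 1 - (a * x) ^ m"
    by (simp only: one_diff_power_eq dvd_triv_left)
  then obtain e where "1 - (a * x) ^ m = b * y * e" by (rule dvdE)
  then have "a ^ m * x ^ m + (b * e) * y = 1"
    by (simp add: algebra_simps power_mult_distrib)
  then show ?thesis by (rule that)
qed

lemma bezout_power:
  fixes x y :: "'a::comm_ring_1"
  assumes "a * x + b * y = 1"
  obtains c d where "c * x ^ m + d * y ^ n = 1"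
proof -
  obtain c d where "c * x ^ m + d * y = 1"
    using assms by (rule bezout_power_left)
  then have "d * y + c * x ^ m = 1" by (simp add: add.commute)
  then obtain c' d' where "c' * y ^ n + d' * x ^ m = 1"
    by (rule bezout_power_left)
  then have "d' * x ^ m + c' * y ^ n = 1" by (simp add: add.commute)
  then show ?thesis by (rule that)
qed

text \<open>The cofactors \<open>u\<close> and \<open>v\<close> of \<open>X - 1\<close> in the two
  differences are coprime, hence so are their \<open>m\<close>-th powers. Multiplying the resulting
  Bezout identity by \<open>(X - 1) ^ m\<close> gives the claim.\<close>

lemma consecutive_difference_bezout:
  fixes n m :: nat
  obtains a b :: "real poly"
  where "(monom 1 1 - 1) ^ m = a * (monom 1 n - 1) ^ m + b * (monom 1 (Suc n) - 1) ^ m"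
proof -
  let ?X = "monom 1 1 :: real poly"
  obtain u where u: "monom 1 n - 1 = (?X - 1) * u"
    using monom_minus_1_dvd by (rule dvdE)
  obtain v where v: "monom 1 (Suc n) - 1 = (?X - 1) * v"
    using monom_minus_1_dvd by (rule dvdE)
  \<comment> \<open>One Euclidean step, followed by cancelling the nonzero factor
    \<open>X - 1\<close>, yields the Bezout identity for \<open>u\<close> and
    \<open>v\<close>.\<close>
  have "(?X - 1) * (v - ?X * u) = (?X - 1) * v - ?X * ((?X - 1) * u)"
    by (simp only: right_diff_distrib mult.left_commute)
  also have "\<dots> = monom 1 (Suc n) - 1 - ?X * (monom 1 n - 1)"
    by (simp only: u v)
  also have "\<dots> = (?X - 1) * 1"
    by (simp add: right_diff_distrib mult_monom)
  finally have "(?X - 1) * (v - ?X * u) = (?X - 1) * 1" .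
  moreover have "?X \<noteq> 1"
    by (simp add: monom_eq_1_iff)
  ultimately have *: "v - ?X * u = 1"
    by (simp only: mult_cancel_left) simp
  have "(- ?X) * u + 1 * v = 1"
    using * by (simp add: algebra_simps)
  then obtain a b where "a * u ^ m + b * v ^ m = 1"
    by (rule bezout_power)
  then have "(?X - 1) ^ m = (?X - 1) ^ m * (a * u ^ m + b * v ^ m)" by simp
  also have "\<dots> = a * (monom 1 n - 1) ^ m + b * (monom 1 (Suc n) - 1) ^ m"
    by (simp only: u v power_mult_distrib) (simp add: algebra_simps)
  finally show ?thesis by (rule that)
qed

section \<open>Powers of m-isometries\<close>

lemma bounded_clinear_funpow:
  fixes A :: "'a::complex_inner \<Rightarrow> 'a"
  assumes "bounded_clinear A"
  shows "bounded_clinear (A ^^ n)"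
proof (induction n)
  case 0
  have "A ^^ 0 = (\<lambda>x. x)" by (simp add: fun_eq_iff)
  then show ?case by (simp only: bounded_clinear_def bounded_linear_ident) simp
next
  case (Suc n)
  have "A ^^ Suc n = (\<lambda>x. A ((A ^^ n) x))" by (simp add: fun_eq_iff)
  then show ?case
    using assms Suc by (simp only: bounded_clinear_def bounded_linear_compose) simp
qed

text \<open>Starting the sequence at \<open>s\<close> amounts to replacing \<open>x\<close> by
  \<open>(A ^^ s) x\<close>. As \<open>x\<close> is arbitrary, annihilation at \<open>s = 0\<close>
  already gives it at every \<open>s\<close>.\<close>

lemma m_isometry_funpow_iff:
  assumes "bounded_clinear A"
  shows "m_isometry m (A ^^ n) \<longleftrightarrow>
    (\<forall>x s. shift_act ((monom 1 n - 1) ^ m) (\<lambda>k. (norm ((A ^^ k) x))\<^sup>2) s = 0)"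
    (is "_ \<longleftrightarrow> ?R")
proof -
  have iter: "((A ^^ n) ^^ k) ((A ^^ s) x) = (A ^^ (s + k * n)) x" for k s x
  proof -
    have "((A ^^ n) ^^ k) ((A ^^ s) x) = (A ^^ (n * k) \<circ> A ^^ s) x"
      by (simp add: funpow_mult)
    also have "\<dots> = (A ^^ (s + k * n)) x"
      by (simp only: funpow_add[symmetric] add.commute mult.commute)
    finally show ?thesis .
  qed
  have "?R \<longleftrightarrow> (\<forall>x s. (\<Sum>k=0..m. real (m choose k) * (-1) ^ (m - k) *
      (norm (((A ^^ n) ^^ k) ((A ^^ s) x)))\<^sup>2) = 0)"
    by (simp only: shift_act_difference_power iter)
  also have "\<dots> \<longleftrightarrow> m_isometry m (A ^^ n)"
  proof
    assume *: "\<forall>x s. (\<Sum>k=0..m. real (m choose k) * (-1) ^ (m - k) *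
      (norm (((A ^^ n) ^^ k) ((A ^^ s) x)))\<^sup>2) = 0"
    show "m_isometry m (A ^^ n)"
      unfolding m_isometry_def using bounded_clinear_funpow[OF assms] *[rule_format, where s = 0]
      by simp
  qed (simp add: m_isometry_def)
  finally show ?thesis ..
qed

lemma m_isometry_funpow:
  assumes "m_isometry m A"
  shows "m_isometry m (A ^^ n)"
proof -
  have A: "bounded_clinear A" using assms by (simp add: m_isometry_def)
  have "\<forall>x s. shift_act ((monom 1 1 - 1) ^ m) (\<lambda>k. (norm ((A ^^ k) x))\<^sup>2) s = 0"
    using m_isometry_funpow_iff[OF A, of m 1] assms by simp
  moreover have "(monom 1 1 - 1 :: real poly) ^ m dvd (monom 1 n - 1) ^ m"
    by (intro dvd_power_same monom_minus_1_dvd)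
  ultimately show ?thesis
    unfolding m_isometry_funpow_iff[OF A] using shift_act_dvd by blast
qed

lemma m_isometry_of_consecutive_powers:
  assumes A: "bounded_clinear A"
    and "m_isometry m (A ^^ n)" and "m_isometry m (A ^^ Suc n)"
  shows "m_isometry m A"
proof -
  obtain a b :: "real poly" where
    ab: "(monom 1 1 - 1) ^ m = a * (monom 1 n - 1) ^ m + b * (monom 1 (Suc n) - 1) ^ m"
    by (rule consecutive_difference_bezout)
  have "shift_act ((monom 1 1 - 1) ^ m) (\<lambda>k. (norm ((A ^^ k) x))\<^sup>2) s = 0" for x s
    unfolding ab shift_act_add
    using assms(2,3)[unfolded m_isometry_funpow_iff[OF A]]
    by (simp add: shift_act_mult_eq_0)
  then have "m_isometry m (A ^^ 1)"
    unfolding m_isometry_funpow_iff[OF A] by blast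
  then show ?thesis by simp
qed

section \<open>Transfer to semigroups\<close>

lemma C0_semigroup_funpow:
  assumes "C0_semigroup T" and "0 \<le> h"
  shows "T (real n * h) = T h ^^ n"
proof (induction n)
  case 0
  then show ?case using assms by (simp add: C0_semigroup_def)
next
  case (Suc n)
  have "T (real n * h + h) = T h \<circ> T (real n * h)"
    using assms unfolding C0_semigroup_def by (meson mult_nonneg_nonneg of_nat_0_le_iff)
  then show ?case using Suc by (simp add: ring_distribs add.commute)
qed

lemma C0_semigroup_m_isometry_small:
  assumes T: "C0_semigroup T"
    and "0 < t1" and iso: "\<forall>t\<in>{t1..t2}. m_isometry m (T t)"
    and h: "0 < h" "2 * h \<le> t2 - t1"
  shows "m_isometry m (T h)"
proof -
  \<comment> \<open>\<open>n * h\<close> is the first multiple of \<open>h\<close> that reaches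
    \<open>t1\<close>. It lies below \<open>t1 + h\<close>, so the next multiple lies below
    \<open>t1 + 2 * h\<close>, hence below \<open>t2\<close>.\<close>
  define n where "n = nat \<lceil>t1 / h\<rceil>"
  have "real n = of_int \<lceil>t1 / h\<rceil>"
    using \<open>0 < t1\<close> h by (simp add: n_def)
  then have "t1 / h \<le> real n" "real n < t1 / h + 1"
    by linarith+
  then have n: "t1 \<le> real n * h" "real n * h < t1 + h"
    using h by (simp_all add: field_simps)
  then have "real n * h \<in> {t1..t2}" "real (Suc n) * h \<in> {t1..t2}"
    using h by (auto simp: algebra_simps)
  then have "m_isometry m (T (real n * h))" "m_isometry m (T (real (Suc n) * h))"
    using iso by blast+
  moreover have "bounded_clinear (T h)"
    using T h by (simp add: C0_semigroup_def)
  ultimately show ?thesis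
    using h by (intro m_isometry_of_consecutive_powers[of "T h" m n])
      (simp_all only: C0_semigroup_funpow[OF T] less_imp_le)
qed

lemma C0_semigroup_m_isometry:
  assumes T: "C0_semigroup T"
    and "0 < t1" "t1 < t2" and iso: "\<forall>t\<in>{t1..t2}. m_isometry m (T t)"
    and "0 \<le> t"
  shows "m_isometry m (T t)"
proof -
  \<comment> \<open>Half the length, so that every positive \<open>h\<close> up to \<open>d\<close>
    leaves room for two consecutive multiples of \<open>h\<close> in the interval.\<close>
  define d where "d = (t2 - t1) / 2"
  have "d > 0" using \<open>t1 < t2\<close> by (simp add: d_def)
  obtain h N where h: "0 < h" "h \<le> d" and t: "t = real N * h"
  proof (cases "t = 0")
    case True
    then show ?thesis using that[of d 0] \<open>d > 0\<close> by simp
  next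
    case False
    with \<open>0 \<le> t\<close> have "t > 0" by simp
    \<comment> \<open>This choice makes the step \<open>t / N\<close> smaller than
      \<open>d\<close>.\<close>
    obtain N where N: "t / d < real N"
      using reals_Archimedean2 by blast
    moreover have "0 < t / d" using \<open>t > 0\<close> \<open>d > 0\<close> by simp
    ultimately have "0 < real N" by linarith
    then show ?thesis
      using that[of "t / real N" N] N \<open>t > 0\<close> \<open>d > 0\<close> by (simp add: field_simps)
  qed
  have "m_isometry m (T h)"
    using C0_semigroup_m_isometry_small[OF T \<open>0 < t1\<close> iso] h by (simp add: d_def)
  then show ?thesis
    using m_isometry_funpow h by (simp add: t C0_semigroup_funpow[OF T])
qed

theorem theorem2p2:
  fixes m :: nat and T :: "real \<Rightarrow> 'a::complex_hilbert_space \<Rightarrow> 'a"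
  assumes "m > 0" and "C0_semigroup T"
  shows "((\<forall>t\<ge>0. m_isometry m (T t)) \<longleftrightarrow>
            (\<exists>t1>0. \<forall>t\<in>{0..t1}. m_isometry m (T t))) \<and>
         ((\<exists>t1>0. \<forall>t\<in>{0..t1}. m_isometry m (T t)) \<longleftrightarrow>
            (\<exists>t1 t2. 0 < t1 \<and> t1 < t2 \<and> (\<forall>t\<in>{t1..t2}. m_isometry m (T t))))"
    (is "(?i \<longleftrightarrow> ?ii) \<and> (?ii \<longleftrightarrow> ?iii)")
proof -
  have "?ii" if ?i
    using that by (intro exI[of _ 1]) simp
  moreover have "?iii" if ?ii
  proof -
    from that obtain t1 where "t1 > 0" "\<forall>t\<in>{0..t1}. m_isometry m (T t)" by blast
    then show ?thesis by (intro exI[of _ "t1 / 2"] exI[of _ t1]) auto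
  qed
  moreover have "?i" if ?iii
    using that C0_semigroup_m_isometry[OF \<open>C0_semigroup T\<close>] by blast
  ultimately show ?thesis by blast
qed

end
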